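(* Let $\ell \le m \le n$ be positive integers. When $\ell m > n$, there exists no unitary tensor in $\mathbb{C}^{\ell \times m \times n}$, and hence \[ \operatorname{App}_3(\mathbb{C};\ell,m,n) > \frac{1}{\sqrt{\ell m}}. \]
   Context: Unitary tensors: a complex vector is unitary if its Euclidean norm is one; for $n_1\le\dots\le n_d$, $d\ge2$, a tensor $\mathbf{X}\in\mathbb{C}^{n_1\times\dots\times n_d}$ is unitary if for every unit vector $u\in\mathbb{C}^{n_1}$ the order-$(d-1)$ tensor $\mathbf{X}\times_1u$ with entries $\sum_{i}u(i)\mathbf{X}(i,i_2,\dots,i_d)$ (no complex conjugation) is unitary. The Frobenius inner product on $\mathbb{C}^{\ell\times m\times n}$ is $\langle\mathbf{X},\mathbf{Y}\rangle_F=\sum_{i,j,k}\overline{\mathbf{X}(i,j,k)}\,\mathbf{Y}(i,j,k)$ with induced norm $\|\cdot\|_F$; the spectral norm is $\|\mathbf{X}\|_2=\max\{|\langle\mathbf{X},u\otimes v\otimes w\rangle_F|: u\in\mathbb{C}^\ell,v\in\mathbb{C}^m,w\in\mathbb{C}^n,\ \|u\|=\|v\|=\|w\|=1\}$, where $u\otimes v\otimes w$ has entries $u_iv_jw_k$; and $\operatorname{App}_3(\mathbb{C};\ell,m,n)=\min_{0\ne\mathbf{X}\in\mathbb{C}^{\ell\times m\times n}}\|\mathbf{X}\|_2/\|\mathbf{X}\|_F$. *)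

theory Defs
  imports "HOL-Analysis.Analysis"
begin

text \<open>A tensor in \<open>\<complex>\<^bsup>l \<times> m \<times> n\<^esup>\<close> is an element of \<open>complex ^ 'n ^ 'm ^ 'l\<close> with entries
  \<open>X $ i $ j $ k\<close>, and \<open>l\<close>, \<open>m\<close>, \<open>n\<close> are the cardinalities of the index types. The library norm
  on \<open>complex ^ 'n\<close> is the Euclidean norm.\<close>

type_synonym ('l, 'm, 'n) tensor3 = "complex ^ 'n ^ 'm ^ 'l"

subsection \<open>Unitary tensors\<close>

definition contract2 :: "complex ^ 'n ^ 'm \<Rightarrow> complex ^ 'm::finite \<Rightarrow> complex ^ 'n" where
  "contract2 A v = (\<chi> k. \<Sum>j\<in>UNIV. v $ j * A $ j $ k)"

definition contract3 :: "('l, 'm, 'n) tensor3 \<Rightarrow> complex ^ 'l::finite \<Rightarrow> complex ^ 'n ^ 'm" where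
  "contract3 X u = (\<chi> j k. \<Sum>i\<in>UNIV. u $ i * X $ i $ j $ k)"

text \<open>The recursion over the order of the tensor, written out for orders 1, 2 and 3. An order-2
  tensor indexed by \<open>'m\<close> and \<open>'n\<close> is contracted along its first index, so it is unitary iff its
  transpose is an isometry.\<close>

definition unitary1 :: "complex ^ 'n::finite \<Rightarrow> bool" where
  "unitary1 x \<longleftrightarrow> norm x = 1"

definition unitary2 :: "complex ^ 'n::finite ^ 'm::finite \<Rightarrow> bool" where
  "unitary2 A \<longleftrightarrow> (\<forall>v. unitary1 v \<longrightarrow> unitary1 (contract2 A v))"

definition unitary3 :: "('l::finite, 'm::finite, 'n::finite) tensor3 \<Rightarrow> bool" where
  "unitary3 X \<longleftrightarrow> (\<forall>u. unitary1 u \<longrightarrow> unitary2 (contract3 X u))"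

subsection \<open>Spectral and Frobenius norm\<close>

definition frob_inner ::
    "('l::finite, 'm::finite, 'n::finite) tensor3 \<Rightarrow> ('l, 'm, 'n) tensor3 \<Rightarrow> complex" where
  "frob_inner X Y = (\<Sum>i\<in>UNIV. \<Sum>j\<in>UNIV. \<Sum>k\<in>UNIV. cnj (X $ i $ j $ k) * Y $ i $ j $ k)"

definition frob_norm :: "('l::finite, 'm::finite, 'n::finite) tensor3 \<Rightarrow> real" where
  "frob_norm X = sqrt (Re (frob_inner X X))"

definition outer3 :: "complex ^ 'l \<Rightarrow> complex ^ 'm \<Rightarrow> complex ^ 'n \<Rightarrow> ('l, 'm, 'n) tensor3" where
  "outer3 u v w = (\<chi> i j k. u $ i * v $ j * w $ k)"

definition spectral_vals :: "('l::finite, 'm::finite, 'n::finite) tensor3 \<Rightarrow> real set" where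
  "spectral_vals X =
     {cmod (frob_inner X (outer3 u v w)) | u v w. norm u = 1 \<and> norm v = 1 \<and> norm w = 1}"

text \<open>The maximum and the minimum below are rendered as \<open>Sup\<close> and \<open>Inf\<close>; that they are attained
  is proved at the end of this theory.\<close>

definition spectral_norm :: "('l::finite, 'm::finite, 'n::finite) tensor3 \<Rightarrow> real" where
  "spectral_norm X = Sup (spectral_vals X)"

definition App3_vals :: "'l::finite itself \<Rightarrow> 'm::finite itself \<Rightarrow> 'n::finite itself \<Rightarrow> real set" where
  "App3_vals _ _ _ = {spectral_norm X / frob_norm X | X :: ('l, 'm, 'n) tensor3. X \<noteq> 0}"

definition App3 :: "'l::finite itself \<Rightarrow> 'm::finite itself \<Rightarrow> 'n::finite itself \<Rightarrow> real" where
  "App3 l m n = Inf (App3_vals l m n)"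

subsection \<open>Attainment\<close>

lemma frob_norm_eq_norm: "frob_norm X = norm X"
proof -
  have "Re (frob_inner X X) = (\<Sum>i\<in>UNIV. \<Sum>j\<in>UNIV. \<Sum>k\<in>UNIV. (cmod (X $ i $ j $ k))\<^sup>2)"
    unfolding frob_inner_def Re_sum
    by (intro sum.cong refl) (simp add: cmod_power2 flip: power2_eq_square)
  then show ?thesis
    by (simp add: frob_norm_def norm_vec_def L2_set_def sum_nonneg)
qed

lemma continuous_frob_inner_outer3:
  "continuous_on UNIV (\<lambda>(X, u, v, w). cmod (frob_inner X (outer3 u v w)))"
  unfolding frob_inner_def outer3_def case_prod_beta
  by (auto intro!: continuous_intros)

abbreviation unit_triples ::
    "((complex ^ 'l::finite) \<times> (complex ^ 'm::finite) \<times> (complex ^ 'n::finite)) set" where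
  "unit_triples \<equiv> sphere 0 1 \<times> sphere 0 1 \<times> sphere 0 1"

lemma spectral_vals_image:
  "spectral_vals X = (\<lambda>(u, v, w). cmod (frob_inner X (outer3 u v w))) ` unit_triples"
  by (force simp: spectral_vals_def image_iff)

lemma compact_spectral_vals: "compact (spectral_vals X)"
proof -
  have "continuous_on unit_triples ((\<lambda>(X, u, v, w). cmod (frob_inner X (outer3 u v w))) \<circ> Pair X)"
    by (intro continuous_on_compose continuous_intros
        continuous_on_subset[OF continuous_frob_inner_outer3]) auto
  then have "continuous_on unit_triples (\<lambda>(u, v, w). cmod (frob_inner X (outer3 u v w)))"
    by (simp add: o_def case_prod_beta)
  then show ?thesis
    unfolding spectral_vals_image by (intro compact_continuous_image compact_Times) auto
qed

lemma spectral_vals_nonempty: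
  fixes X :: "('l::finite, 'm::finite, 'n::finite) tensor3"
  shows "spectral_vals X \<noteq> {}"
proof -
  have "\<exists>u :: complex ^ 'l. norm u = 1" "\<exists>v :: complex ^ 'm. norm v = 1"
    "\<exists>w :: complex ^ 'n. norm w = 1"
    using vector_choose_size zero_le_one by blast+
  then show ?thesis unfolding spectral_vals_def by blast
qed

lemma spectral_norm_attained:
  "spectral_norm X \<in> spectral_vals X \<and> (\<forall>r \<in> spectral_vals X. r \<le> spectral_norm X)"
  unfolding spectral_norm_def
  using compact_spectral_vals[of X] spectral_vals_nonempty[of X]
  by (meson bounded_imp_bdd_above cSup_upper closed_contains_Sup compact_imp_bounded
      compact_imp_closed)

lemma spectral_norm_le_iff:
  "spectral_norm X \<le> r \<longleftrightarrow>
    (\<forall>u v w. norm u = 1 \<longrightarrow> norm v = 1 \<longrightarrow> norm w = 1 \<longrightarrow> cmod (frob_inner X (outer3 u v w)) \<le> r)"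
proof -
  have "spectral_norm X \<le> r \<longleftrightarrow> (\<forall>s \<in> spectral_vals X. s \<le> r)"
    using spectral_norm_attained[of X] order_trans by blast
  then show ?thesis
    unfolding spectral_vals_def by blast
qed

lemma spectral_norm_nonneg: "0 \<le> spectral_norm X"
  using spectral_norm_attained[of X] unfolding spectral_vals_def by fastforce

lemma closed_spectral_norm_le:
  "closed {X :: ('l::finite, 'm::finite, 'n::finite) tensor3. spectral_norm X \<le> r}"
proof -
  have *: "{X :: ('l, 'm, 'n) tensor3. spectral_norm X \<le> r} =
     (\<Inter>u \<in> sphere 0 1. \<Inter>v \<in> sphere 0 1. \<Inter>w \<in> sphere 0 1.
       {X. cmod (frob_inner X (outer3 u v w)) \<le> r})"
    by (auto simp: spectral_norm_le_iff)
  have "closed {X :: ('l, 'm, 'n) tensor3. cmod (frob_inner X (outer3 u v w)) \<le> r}" for u v w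
    unfolding frob_inner_def by (intro closed_Collect_le continuous_intros)
  then show ?thesis
    unfolding * by (intro closed_INT ballI)
qed

lemma frob_inner_scaleR: "frob_inner (c *\<^sub>R X) Y = of_real c * frob_inner X Y"
proof -
  have "cnj ((c *\<^sub>R X) $ i $ j $ k) * Y $ i $ j $ k =
      of_real c * (cnj (X $ i $ j $ k) * Y $ i $ j $ k)" for i j k
    by (simp add: scaleR_conv_of_real[where 'a=complex] mult.assoc)
  then show ?thesis by (simp only: frob_inner_def sum_distrib_left)
qed

lemma spectral_norm_scaleR_le:
  assumes "c \<ge> 0" shows "spectral_norm (c *\<^sub>R X) \<le> c * spectral_norm X"
  unfolding spectral_norm_le_iff frob_inner_scaleR norm_mult
  using assms spectral_norm_le_iff[of X "spectral_norm X"] by (simp add: mult_left_mono)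

lemma App3_attained:
  "App3 TYPE('l::finite) TYPE('m::finite) TYPE('n::finite) \<in> App3_vals TYPE('l) TYPE('m) TYPE('n)
    \<and> (\<forall>r \<in> App3_vals TYPE('l) TYPE('m) TYPE('n). App3 TYPE('l) TYPE('m) TYPE('n) \<le> r)"
proof -
  let ?V = "App3_vals TYPE('l) TYPE('m) TYPE('n)"
  let ?a = "App3 TYPE('l) TYPE('m) TYPE('n)"
  let ?S = "sphere (0 :: ('l, 'm, 'n) tensor3) 1"
  let ?C = "\<lambda>r. ?S \<inter> {X. spectral_norm X \<le> r}"
  have unit: "\<exists>Y \<in> ?S. spectral_norm Y \<le> r" if r: "r \<in> ?V" for r
  proof -
    from r obtain X :: "('l, 'm, 'n) tensor3"
      where X: "X \<noteq> 0" "r = spectral_norm X / norm X"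
      unfolding App3_vals_def frob_norm_eq_norm by blast
    then have "spectral_norm (inverse (norm X) *\<^sub>R X) \<le> r"
      using spectral_norm_scaleR_le[of "inverse (norm X)" X] by (simp add: divide_inverse mult.commute)
    moreover have "inverse (norm X) *\<^sub>R X \<in> ?S" using X by simp
    ultimately show ?thesis by blast
  qed
  have mem: "spectral_norm Y \<in> ?V" if "Y \<in> ?S" for Y
    using that unfolding App3_vals_def frob_norm_eq_norm
    by (intro CollectI exI[of _ Y]) auto
  have bdd: "bdd_below ?V"
    unfolding App3_vals_def frob_norm_eq_norm
    by (intro bdd_belowI[of _ 0]) (auto simp: spectral_norm_nonneg)
  obtain Z :: "('l, 'm, 'n) tensor3" where "norm Z = 1"
    using vector_choose_size zero_le_one by blast
  then have ne: "?V \<noteq> {}" using mem by fastforce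
  have low: "?a \<le> r" if "r \<in> ?V" for r
    unfolding App3_def using that bdd by (rule cInf_lower)
  have "?S \<inter> (\<Inter>r \<in> ?V. ?C r) \<noteq> {}"
  proof (rule compact_imp_fip_image)
    show "compact ?S" by simp
    show "closed (?C r)" for r by (intro closed_Int closed_spectral_norm_le) simp
    fix F assume F: "finite F" "F \<subseteq> ?V"
    show "?S \<inter> (\<Inter>r \<in> F. ?C r) \<noteq> {}"
    proof (cases "F = {}")
      case True
      then show ?thesis using \<open>norm Z = 1\<close> by auto
    next
      case False
      then obtain Y where "Y \<in> ?S" "spectral_norm Y \<le> Min F"
        using unit[of "Min F"] F Min_in by blast
      then have "Y \<in> ?S \<inter> (\<Inter>r \<in> F. ?C r)"
        using F by (auto intro: order_trans[OF _ Min_le])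
      then show ?thesis by blast
    qed
  qed
  then obtain Y where Y: "Y \<in> ?S" "\<forall>r \<in> ?V. spectral_norm Y \<le> r" by blast
  have "spectral_norm Y \<le> ?a"
    unfolding App3_def using ne Y(2) by (intro cInf_greatest) auto
  then have "?a = spectral_norm Y" using low[OF mem[OF Y(1)]] by simp
  then show ?thesis using mem[OF Y(1)] low by simp
qed

end

theory Submission
  imports Defs
begin

text \<open>A tensor \<open>X\<close> is used through the complex bilinear map \<open>B u v = X \<times>\<^sub>1 u \<times>\<^sub>1 v\<close> from
  \<open>\<complex>\<^sup>l \<times> \<complex>\<^sup>m\<close> to \<open>\<complex>\<^sup>n\<close>. The tensor is unitary iff \<open>B\<close> is multiplicative for the norms, that is
  \<open>\<parallel>B u v\<parallel> = \<parallel>u\<parallel> \<parallel>v\<parallel>\<close> for all \<open>u\<close> and \<open>v\<close>.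

  Over the complex numbers this identity can be polarized separately in \<open>u\<close> and in \<open>v\<close>, so \<open>B\<close>
  carries the Hermitian inner product of \<open>\<complex>\<^sup>l \<otimes> \<complex>\<^sup>m\<close> to that of \<open>\<complex>\<^sup>n\<close>. In particular the \<open>l m\<close>
  vectors \<open>B e\<^sub>i e\<^sub>j\<close> are nonzero and pairwise orthogonal in \<open>\<complex>\<^sup>n\<close>, and \<open>l m \<le> n\<close>
  (\<open>multiplicative_norm_card_le\<close>). Complex scalars are essential here: over the reals the
  quaternions provide such a map with \<open>l = m = n = 4\<close>.

  For the second claim, let \<open>X \<noteq> 0\<close> satisfy \<open>\<parallel>X\<parallel>\<^sub>2 \<le> \<parallel>X\<parallel>\<^sub>F / \<surd>(l m)\<close> and call the right-hand side \<open>K\<close>. Then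
  \<open>\<parallel>B u v\<parallel> \<le> K \<parallel>u\<parallel> \<parallel>v\<parallel>\<close>, while the squares of the \<open>l m\<close> numbers \<open>\<parallel>B e\<^sub>i e\<^sub>j\<parallel>\<close> add up to
  \<open>\<parallel>X\<parallel>\<^sub>F\<^sup>2 = l m K\<^sup>2\<close>; hence all of them equal \<open>K\<close>. The vectors on which a linear map attains a
  given norm bound form a subspace (\<open>norm_attaining_subspace\<close>), and so the equality spreads from
  the basis vectors to all \<open>u\<close> and \<open>v\<close>, one argument at a time. Thus \<open>X / K\<close> is unitary
  (\<open>unitary3_of_spectral_norm_le\<close>), which the first claim excludes. As the minimum \<open>App3\<close> is
  attained, the strict inequality for each \<open>X\<close> gives the strict inequality for \<open>App3\<close>.\<close>

section \<open>Complex bilinear maps\<close>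

lemma norm_vector_scalar_mult: "norm (c *s (x :: complex ^ 'n)) = cmod c * norm x"
  by (simp add: norm_vec_def L2_set_def norm_mult power_mult_distrib real_sqrt_mult
      flip: sum_distrib_left)

lemma norm_axis: "norm (axis i x) = norm x"
  by (simp add: norm_vec_def L2_set_def axis_def if_distrib[of norm] if_distrib[of "\<lambda>y. y\<^sup>2"]
      cong: if_cong)

lemma norm_cnj: "norm (\<chi> i. cnj (x $ i)) = norm x"
  by (simp add: norm_vec_def)

lemma inner_ii_ii: "inner (\<i> *s x) (\<i> *s y) = inner x (y :: complex ^ 'n)"
  by (simp add: inner_vec_def inner_complex_def add.commute)

lemma inner_ii_self: "inner x (\<i> *s x) = 0" "inner (\<i> *s x) (x :: complex ^ 'n) = 0"
  by (simp_all add: inner_vec_def inner_complex_def)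

abbreviation complex_linear :: "(complex ^ 'm \<Rightarrow> complex ^ 'n) \<Rightarrow> bool" where
  "complex_linear \<equiv> Vector_Spaces.linear (*s) (*s)"

definition complex_bilinear :: "(complex ^ 'l \<Rightarrow> complex ^ 'm \<Rightarrow> complex ^ 'n) \<Rightarrow> bool" where
  "complex_bilinear B \<longleftrightarrow> (\<forall>u. complex_linear (B u)) \<and> (\<forall>v. complex_linear (\<lambda>u. B u v))"

lemma complex_bilinear_swap: "complex_bilinear B \<Longrightarrow> complex_bilinear (\<lambda>v u. B u v)"
  by (simp add: complex_bilinear_def)

lemma complex_bilinear_simps:
  assumes "complex_bilinear B"
  shows "B (u + u') v = B u v + B u' v" "B u (v + v') = B u v + B u v'"
    and "B (c *s u) v = c *s B u v" "B u (c *s v) = c *s B u v"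
proof -
  interpret left: Vector_Spaces.linear "(*s)" "(*s)" "\<lambda>u. B u v"
    using assms by (simp add: complex_bilinear_def)
  interpret right: Vector_Spaces.linear "(*s)" "(*s)" "B u"
    using assms by (simp add: complex_bilinear_def)
  show "B (u + u') v = B u v + B u' v" "B u (v + v') = B u v + B u v'"
    "B (c *s u) v = c *s B u v" "B u (c *s v) = c *s B u v"
    by (rule left.add right.add left.scale right.scale)+
qed

text \<open>The vector \<open>0\<close> is included, as the zero multiple of an arbitrary unit vector.\<close>

lemma multiple_of_unit_vector:
  fixes u :: "complex ^ 'l::finite"
  obtains e where "norm e = 1" "u = of_real (norm u) *s e"
proof (cases "u = 0")
  case True
  obtain e :: "complex ^ 'l" where "norm e = 1"
    using vector_choose_size zero_le_one by blast
  with True that show ?thesis by simp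
next
  case False
  show ?thesis
  proof (rule that)
    show "norm (of_real (1 / norm u) *s u) = 1"
      using False by (simp add: norm_vector_scalar_mult norm_divide)
    show "u = of_real (norm u) *s (of_real (1 / norm u) *s u)"
      using False by (simp add: vec_eq_iff)
  qed
qed

lemma bilinear_at_unit_vectors:
  assumes B: "complex_bilinear B"
  obtains e f where "norm e = 1" "norm f = 1" "norm (B u v) = norm (B e f) * (norm u * norm v)"
proof -
  obtain e where e: "norm e = 1" "u = of_real (norm u) *s e" using multiple_of_unit_vector .
  obtain f where f: "norm f = 1" "v = of_real (norm v) *s f" using multiple_of_unit_vector .
  have "norm (B u v) = norm (B e f) * (norm u * norm v)"
    using arg_cong2[OF e(2) f(2), of B]
    by (simp add: complex_bilinear_simps[OF B] norm_vector_scalar_mult norm_mult mult_ac)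
  with e(1) f(1) show ?thesis by (rule that)
qed

section \<open>Bilinear maps that are multiplicative for the norm\<close>

text \<open>The real inner product is the real part of the Hermitian one, so the two hypotheses on
  \<open>u\<close> and \<open>u'\<close> together say that these vectors are Hermitian orthogonal. Polarization in the
  first argument makes \<open>B u v\<close> and \<open>B u' v\<close> orthogonal. Polarization in the second one then gives
  only that \<open>inner (B u v) (B u' v')\<close> is alternating in \<open>v, v'\<close>; the same for
  \<open>\<i> u'\<close> and \<open>\<i> v'\<close> says that it is also symmetric, and so it vanishes.\<close>

lemma multiplicative_norm_orthogonal:
  fixes B :: "complex ^ 'l \<Rightarrow> complex ^ 'm \<Rightarrow> complex ^ 'n"
  assumes B: "complex_bilinear B" and mult: "\<And>u v. norm (B u v) = norm u * norm v"
    and orth: "inner u u' = 0" "inner u (\<i> *s u') = 0"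
  shows "inner (B u v) (B u' v') = 0"
proof -
  note simps = complex_bilinear_simps[OF B]
  have diag: "inner (B a v) (B b v) = 0" if "inner a b = 0" for a b v
  proof -
    have "inner (B a v) (B b v) =
        ((norm (B (a + b) v))\<^sup>2 - (norm (B a v))\<^sup>2 - (norm (B b v))\<^sup>2) / 2"
      by (simp add: simps dot_norm)
    also have "\<dots> = inner a b * (norm v)\<^sup>2"
      by (simp add: mult dot_norm power_mult_distrib field_simps)
    finally show ?thesis using that by simp
  qed
  have alt: "inner (B a v) (B b v') + inner (B a v') (B b v) = 0" if "inner a b = 0" for a b v v'
    using diag[OF that, of "v + v'"] diag[OF that, of v] diag[OF that, of v']
    by (simp add: simps inner_add_left inner_add_right)
  have "\<i> *s (\<i> *s x) = - x" for x :: "complex ^ 'n"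
    by (simp add: vec_eq_iff)
  then have "- inner (B u v) (B u' v') + inner (B u v') (B u' v) = 0"
    using alt[OF orth(2), of v "\<i> *s v'"] by (simp add: simps inner_ii_ii)
  with alt[OF orth(1), of v v'] show ?thesis by simp
qed

text \<open>The dimension is counted over the reals, where \<open>\<complex>\<^sup>n\<close> has dimension \<open>2 n\<close> and each
  \<open>B e\<^sub>i e\<^sub>j\<close> contributes the two orthogonal vectors \<open>B e\<^sub>i e\<^sub>j\<close> and \<open>\<i> B e\<^sub>i e\<^sub>j\<close>.\<close>

lemma multiplicative_norm_card_le:
  fixes B :: "complex ^ 'l::finite \<Rightarrow> complex ^ 'm::finite \<Rightarrow> complex ^ 'n::finite"
  assumes B: "complex_bilinear B" and mult: "\<And>u v. norm (B u v) = norm u * norm v"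
  shows "CARD('l) * CARD('m) \<le> CARD('n)"
proof -
  note simps = complex_bilinear_simps[OF B]
  define I :: "('l \<times> 'm \<times> complex) set" where "I = UNIV \<times> UNIV \<times> {1, \<i>}"
  define b where "b = (\<lambda>(i, j, c). c *s B (axis i 1) (axis j 1))"
  have axes: "inner (c *s axis i 1) (d *s axis i' 1) = 0" if "i \<noteq> i'" for c d :: complex and i i' :: "'a::finite"
    using that by (auto simp: inner_vec_def axis_def intro!: sum.neutral)
  have left: "inner (b (i, j, c)) (b (i', j', d)) = 0" if "i \<noteq> i'" for i i' j j' c d
  proof -
    have "inner (B (c *s axis i 1) (axis j 1)) (B (d *s axis i' 1) (axis j' 1)) = 0"
      using axes[OF that, of c d] axes[OF that, of c "\<i> * d"]
      by (intro multiplicative_norm_orthogonal[OF B mult]) simp_all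
    then show ?thesis by (simp add: b_def simps)
  qed
  have right: "inner (b (i, j, c)) (b (i', j', d)) = 0" if "j \<noteq> j'" for i i' j j' c d
  proof -
    have "inner (B (axis i 1) (c *s axis j 1)) (B (axis i' 1) (d *s axis j' 1)) = 0"
      using axes[OF that, of c d] axes[OF that, of c "\<i> * d"]
      by (intro multiplicative_norm_orthogonal[OF complex_bilinear_swap[OF B]])
        (simp_all add: mult mult.commute)
    then show ?thesis by (simp add: b_def simps)
  qed
  have orth: "inner (b p) (b q) = 0" if mem: "p \<in> I" "q \<in> I" and neq: "p \<noteq> q" for p q
  proof -
    obtain i j c i' j' d where pq: "p = (i, j, c)" "q = (i', j', d)"
      by (metis prod_cases3)
    consider "i \<noteq> i'" | "j \<noteq> j'" | "i = i'" "j = j'" "c \<noteq> d"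
      using neq pq by blast
    then show ?thesis
    proof cases
      case 3
      then show ?thesis using mem pq by (auto simp: I_def b_def inner_ii_self)
    qed (use left right pq in auto)
  qed
  have norm_b: "norm (b p) = 1" if "p \<in> I" for p
    using that by (auto simp: I_def b_def norm_vector_scalar_mult mult norm_axis)
  then have nonzero: "b p \<noteq> 0" if "p \<in> I" for p
    using that by fastforce
  have inj: "inj_on b I"
    using orth nonzero by (metis inj_onI inner_eq_zero_iff)
  have "pairwise orthogonal (b ` I)"
    using orth unfolding pairwise_def orthogonal_def by blast
  then have "independent (b ` I)"
    using nonzero by (intro pairwise_orthogonal_independent) auto
  then have "card (b ` I) \<le> DIM(complex ^ 'n)"
    by (rule independent_bound[THEN conjunct2])
  moreover have "card I = CARD('l) * (CARD('m) * 2)"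
    by (simp add: I_def card_cartesian_product complex_eq_iff)
  ultimately show ?thesis by (simp add: card_image[OF inj])
qed

section \<open>Attaining a norm bound\<close>

text \<open>Since \<open>f\<close> is bounded by \<open>K\<close>, the defect \<open>K\<^sup>2 \<parallel>x\<parallel>\<^sup>2 - \<parallel>f x\<parallel>\<^sup>2\<close> is nonnegative. It satisfies
  the parallelogram law, and so with \<open>x\<close> and \<open>y\<close> its zeros include \<open>x + y\<close>.\<close>

lemma norm_attaining_subspace:
  fixes f :: "complex ^ 'm \<Rightarrow> complex ^ 'n"
  assumes f: "complex_linear f" and bound: "\<And>x. norm (f x) \<le> K * norm x"
  shows "vec.subspace {x. norm (f x) = K * norm x}"
proof (rule vec.subspaceI)
  interpret f: Vector_Spaces.linear "(*s)" "(*s)" f by fact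
  show "0 \<in> {x. norm (f x) = K * norm x}" by (simp add: f.zero)
  fix x assume x: "x \<in> {x. norm (f x) = K * norm x}"
  then show "c *s x \<in> {x. norm (f x) = K * norm x}" for c
    by (simp add: f.scale norm_vector_scalar_mult)
  fix y assume y: "y \<in> {x. norm (f x) = K * norm x}"
  have parallelogram: "(norm (a + b))\<^sup>2 + (norm (a - b))\<^sup>2 = 2 * (norm a)\<^sup>2 + 2 * (norm b)\<^sup>2"
    for a b :: "'a::real_inner"
    by (simp add: power2_norm_eq_inner inner_simps inner_commute)
  have sq: "(norm (f z))\<^sup>2 \<le> K\<^sup>2 * (norm z)\<^sup>2" for z
    using power_mono[OF bound[of z], of 2] by (simp add: power_mult_distrib)
  have "(norm (f (x + y)))\<^sup>2 + (norm (f (x - y)))\<^sup>2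
      = K\<^sup>2 * ((norm (x + y))\<^sup>2 + (norm (x - y))\<^sup>2)"
    unfolding f.add f.diff parallelogram using x y by (simp add: power_mult_distrib algebra_simps)
  with sq[of "x - y"] have "(K * norm (x + y))\<^sup>2 \<le> (norm (f (x + y)))\<^sup>2"
    by (simp add: distrib_left power_mult_distrib)
  then have "K * norm (x + y) \<le> norm (f (x + y))"
    by (rule power2_le_imp_le) simp
  with bound[of "x + y"] show "x + y \<in> {x. norm (f x) = K * norm x}"
    by (intro CollectI antisym)
qed

lemma norm_attaining_on_axes:
  fixes f :: "complex ^ 'm::finite \<Rightarrow> complex ^ 'n"
  assumes "complex_linear f" "\<And>x. norm (f x) \<le> K * norm x" "\<And>j. norm (f (axis j 1)) = K"
  shows "norm (f x) = K * norm x"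
proof -
  note subspace = norm_attaining_subspace[OF assms(1,2)]
  have "(\<Sum>j\<in>UNIV. x $ j *s axis j 1) \<in> {x. norm (f x) = K * norm x}"
    by (intro vec.subspace_sum[OF subspace] vec.subspace_scale[OF subspace])
      (simp add: assms(3) norm_axis)
  then show ?thesis by (simp add: basis_expansion)
qed

lemma bilinear_norm_attaining_on_axes:
  fixes B :: "complex ^ 'l::finite \<Rightarrow> complex ^ 'm::finite \<Rightarrow> complex ^ 'n"
  assumes B: "complex_bilinear B" and bound: "\<And>u v. norm (B u v) \<le> K * (norm u * norm v)"
    and axes: "\<And>i j. norm (B (axis i 1) (axis j 1)) = K"
  shows "norm (B u v) = K * (norm u * norm v)"
proof -
  have lin: "complex_linear (B u)" "complex_linear (\<lambda>u. B u v)" for u v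
    using B by (simp_all add: complex_bilinear_def)
  have "norm (B (axis i 1) v) = K * norm v" for i v
    using bound[of "axis i 1"] by (intro norm_attaining_on_axes lin axes) (simp add: norm_axis)
  then have "norm (B u v) = K * norm v * norm u"
    using bound[of _ v] by (intro norm_attaining_on_axes[OF lin(2)]) (simp_all add: mult_ac)
  then show ?thesis by (simp add: mult_ac)
qed

section \<open>Tensors as bilinear maps\<close>

definition tensor_map ::
    "('l::finite, 'm::finite, 'n::finite) tensor3 \<Rightarrow> complex ^ 'l \<Rightarrow> complex ^ 'm \<Rightarrow> complex ^ 'n" where
  "tensor_map X u v = contract2 (contract3 X u) v"

lemma tensor_map_nth:
  "tensor_map X u v $ k = (\<Sum>j\<in>UNIV. \<Sum>i\<in>UNIV. v $ j * u $ i * X $ i $ j $ k)"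
  by (simp add: tensor_map_def contract2_def contract3_def sum_distrib_left mult.assoc)

lemma complex_bilinear_tensor_map: "complex_bilinear (tensor_map X)"
  by (simp add: complex_bilinear_def Vector_Spaces.linear_iff vec.vector_space_axioms vec_eq_iff
      tensor_map_nth distrib_left distrib_right sum.distrib sum_distrib_left mult_ac)

lemma tensor_map_axis: "tensor_map X (axis i 1) (axis j 1) = X $ i $ j"
proof -
  have "(if a then 1 else 0) * (if b then 1 else 0) * y = (if b then if a then y else 0 else 0)"
    for a b and y :: complex by simp
  then show ?thesis by (simp add: vec_eq_iff tensor_map_nth axis_def)
qed

lemma tensor_map_scaleR: "tensor_map (c *\<^sub>R X) u v = c *\<^sub>R tensor_map X u v"
  by (simp add: vec_eq_iff tensor_map_nth scaleR_sum_right)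

lemma unitary3_iff: "unitary3 X \<longleftrightarrow> (\<forall>u v. norm (tensor_map X u v) = norm u * norm v)"
proof
  assume unitary: "unitary3 X"
  have unit: "norm (tensor_map X u v) = 1" if "norm u = 1" "norm v = 1" for u v
    using unitary that by (simp add: unitary3_def unitary2_def unitary1_def tensor_map_def)
  show "\<forall>u v. norm (tensor_map X u v) = norm u * norm v"
  proof (intro allI)
    fix u v
    obtain e f where "norm e = 1" "norm f = 1"
      and "norm (tensor_map X u v) = norm (tensor_map X e f) * (norm u * norm v)"
      using bilinear_at_unit_vectors[OF complex_bilinear_tensor_map] .
    then show "norm (tensor_map X u v) = norm u * norm v"
      using unit by simp
  qed
qed (simp add: unitary3_def unitary2_def unitary1_def tensor_map_def)

section \<open>The spectral norm\<close>

text \<open>The spectral norm pairs \<open>X\<close> conjugated with \<open>u \<otimes> v \<otimes> w\<close>, whereas the contraction has no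
  conjugate. Taking the conjugates of \<open>u\<close> and \<open>v\<close> makes up for this, and the best \<open>w\<close> is the
  normalized contraction.\<close>

lemma norm_tensor_map_le_spectral_norm:
  assumes "norm u = 1" "norm v = 1"
  shows "norm (tensor_map X u v) \<le> spectral_norm X"
proof (cases "tensor_map X u v = 0")
  case True
  then show ?thesis by (simp add: spectral_norm_nonneg)
next
  case False
  define z where "z = tensor_map X u v"
  define w where "w = complex_of_real (1 / norm z) *s z"
  have z: "z \<noteq> 0" using False by (simp add: z_def)
  have "norm w = 1" using z by (simp add: w_def norm_vector_scalar_mult norm_divide)
  then have le: "cmod (frob_inner X (outer3 (\<chi> i. cnj (u $ i)) (\<chi> j. cnj (v $ j)) w))
      \<le> spectral_norm X"
    using spectral_norm_le_iff[of X "spectral_norm X"] assms by (simp add: norm_cnj)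
  have "frob_inner X (outer3 (\<chi> i. cnj (u $ i)) (\<chi> j. cnj (v $ j)) w)
      = (\<Sum>i\<in>UNIV. \<Sum>j\<in>UNIV. \<Sum>k\<in>UNIV. cnj (v $ j * u $ i * X $ i $ j $ k) * w $ k)"
    by (simp add: frob_inner_def outer3_def mult_ac)
  also have "\<dots> = (\<Sum>j\<in>UNIV. \<Sum>k\<in>UNIV. \<Sum>i\<in>UNIV. cnj (v $ j * u $ i * X $ i $ j $ k) * w $ k)"
    by (subst sum.swap, rule sum.cong[OF refl], rule sum.swap)
  also have "\<dots> = (\<Sum>k\<in>UNIV. cnj (z $ k) * w $ k)"
    by (subst sum.swap) (simp add: z_def tensor_map_nth sum_distrib_right)
  also have "\<dots> = complex_of_real (1 / norm z) * (\<Sum>k\<in>UNIV. cnj (z $ k) * z $ k)"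
    by (simp add: w_def sum_distrib_left mult_ac)
  also have "(\<Sum>k\<in>UNIV. cnj (z $ k) * z $ k) = complex_of_real ((norm z)\<^sup>2)"
    unfolding norm_vec_def L2_set_def
    by (simp add: sum_nonneg mult.commute flip: complex_norm_square)
  finally show ?thesis
    using le z by (simp add: norm_mult norm_divide z_def power2_eq_square)
qed

lemma norm_tensor_map_le: "norm (tensor_map X u v) \<le> spectral_norm X * (norm u * norm v)"
proof -
  obtain e f where "norm e = 1" "norm f = 1"
    and "norm (tensor_map X u v) = norm (tensor_map X e f) * (norm u * norm v)"
    using bilinear_at_unit_vectors[OF complex_bilinear_tensor_map] .
  then show ?thesis
    by (simp add: norm_tensor_map_le_spectral_norm mult_right_mono)
qed

lemma unitary3_of_spectral_norm_le:
  fixes X :: "('l::finite, 'm::finite, 'n::finite) tensor3"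
  defines "K \<equiv> norm X / sqrt (real (CARD('l) * CARD('m)))"
  assumes X: "X \<noteq> 0" and le: "spectral_norm X \<le> K"
  shows "unitary3 (inverse K *\<^sub>R X)"
proof -
  have K: "K > 0" using X by (simp add: K_def)
  have bound: "norm (tensor_map X u v) \<le> K * (norm u * norm v)" for u v
    using norm_tensor_map_le[of X u v] mult_right_mono[OF le, of "norm u * norm v"] by simp
  have entry_le: "norm (X $ i $ j) \<le> K" for i j
    using bound[of "axis i 1" "axis j 1"] by (simp add: tensor_map_axis norm_axis)
  have "(norm X)\<^sup>2 = (\<Sum>i\<in>UNIV. \<Sum>j\<in>UNIV. (norm (X $ i $ j))\<^sup>2)"
    by (simp add: norm_vec_def[of X] norm_vec_def[where 'b='m] L2_set_def sum_nonneg)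
  moreover have "(norm X)\<^sup>2 = (\<Sum>i\<in>(UNIV :: 'l set). \<Sum>j\<in>(UNIV :: 'm set). K\<^sup>2)"
    by (simp add: K_def power_divide)
  ultimately have "(\<Sum>i\<in>UNIV. \<Sum>j\<in>UNIV. K\<^sup>2 - (norm (X $ i $ j))\<^sup>2) = 0"
    by (simp add: sum_subtractf)
  then have "K\<^sup>2 - (norm (X $ i $ j))\<^sup>2 = 0" for i j
    using entry_le by (simp add: sum_nonneg_eq_0_iff sum_nonneg power_mono)
  then have "norm (X $ i $ j) = K" for i j
    using K by (metis eq_iff_diff_eq_0 less_imp_le norm_ge_zero power2_eq_imp_eq)
  then have "norm (tensor_map X u v) = K * (norm u * norm v)" for u v
    by (intro bilinear_norm_attaining_on_axes complex_bilinear_tensor_map bound)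
      (simp add: tensor_map_axis)
  then show ?thesis
    using K by (simp add: unitary3_iff tensor_map_scaleR)
qed

section \<open>Nonexistence of unitary tensors and the spectral bound\<close>

theorem theorem4p3:
  assumes "CARD('l::finite) \<le> CARD('m::finite)"
    and "CARD('m) \<le> CARD('n::finite)"
    and "CARD('l) * CARD('m) > CARD('n)"
  shows "(\<nexists>X :: ('l, 'm, 'n) tensor3. unitary3 X)
    \<and> App3 TYPE('l) TYPE('m) TYPE('n) > 1 / sqrt (real (CARD('l) * CARD('m)))"
proof
  show no_unitary: "\<nexists>X :: ('l, 'm, 'n) tensor3. unitary3 X"
  proof
    assume "\<exists>X :: ('l, 'm, 'n) tensor3. unitary3 X"
    then obtain X :: "('l, 'm, 'n) tensor3" where "unitary3 X" by blast
    then have "CARD('l) * CARD('m) \<le> CARD('n)"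
      by (intro multiplicative_norm_card_le[OF complex_bilinear_tensor_map[of X]])
        (simp add: unitary3_iff)
    with assms(3) show False by simp
  qed
  obtain X :: "('l, 'm, 'n) tensor3" where X: "X \<noteq> 0"
    and App: "App3 TYPE('l) TYPE('m) TYPE('n) = spectral_norm X / norm X"
    using App3_attained[where 'l='l and 'm='m and 'n='n]
    unfolding App3_vals_def frob_norm_eq_norm by blast
  have "norm X / sqrt (real (CARD('l) * CARD('m))) < spectral_norm X"
    using unitary3_of_spectral_norm_le[OF X] no_unitary by force
  then show "App3 TYPE('l) TYPE('m) TYPE('n) > 1 / sqrt (real (CARD('l) * CARD('m)))"
    using X unfolding App by (simp add: field_simps)
qed

end
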